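(* Let $p,q,r,s\in(-\infty,-1]\cup[0,\infty)$. The inequalities $$\frac{2p+(p+3)\cos t}{(3p+1)+2\cos t}<\cos^{1/3}t<\frac{2q+(q+3)\cos t}{(3q+1)+2\cos t}<\frac{\sin t}{t}<\frac{2r+(r+3)\cos t}{(3r+1)+2\cos t}<\frac{2+\cos t}{3}<\frac{2s+(s+3)\cos t}{(3s+1)+2\cos t}$$ hold for all $t\in(0,\pi/2)$ if and only if $p=0$, $q\in[1,p_0]$, $r\in[9,\infty)$ and $s\in(-\infty,-1]$, where $p_0=(\pi-3)^{-1}$.
   Context: $\cos^{1/3}t$ denotes $(\cos t)^{1/3}$. *)

theory Defs
  imports Complex_Main
begin

end

theory Submission
  imports Defs
begin

text \<open>Write \<open>c = cos t\<close>. For fixed \<open>c\<close> with \<open>0 < c < 1\<close> the fraction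
  \<open>(2p + (p+3)c) / (3p + 1 + 2c)\<close> is a Moebius function of \<open>p\<close> that increases on either side
  of its pole and tends to the Cusa bound \<open>(2 + c)/3\<close> at infinity; the pole lies strictly
  between \<open>-1\<close> and \<open>0\<close>. The function is therefore
  below the Cusa bound for \<open>p \<ge> 0\<close> and above it for \<open>p \<le> -1\<close>. This settles \<open>s\<close>, and it forces
  \<open>p\<close>, \<open>q\<close>, \<open>r\<close> to be nonnegative, because the chain puts their fractions below the Cusa
  bound. From there on each parameter is governed by comparisons with one function at a time.

  The comparison with the cube root is algebraic: for \<open>c = u\<^sup>3\<close> the difference of the fraction
  and \<open>u\<close> has the double zero \<open>u = 1\<close>, and the remaining factor \<open>p(2+u) - u(1+2u)\<close> has a sign
  that can be read off, the critical ends being \<open>u = 0\<close> (which gives \<open>p = 0\<close>) and \<open>u = 1\<close>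
  (which gives \<open>q \<ge> 1\<close>).

  For the comparison with \<open>sin t / t\<close> the variable \<open>t\<close> is isolated: the fraction minus
  \<open>sin t / t\<close> has the sign of \<open>t - sin t (3p + 1 + 2c) / (2p + (p+3)c)\<close>, called \<open>gap p t\<close> below. It vanishes at \<open>0\<close>, and
  its derivative no longer contains \<open>t\<close>; it has the sign of \<open>p\<^sup>2 - 6p - 3 - 2(p+3)c\<close>, an
  increasing function of \<open>t\<close> with the value \<open>(p-9)(p+1)\<close> at \<open>t = 0\<close>. So for \<open>p \<ge> 9\<close> the gap
  increases and is positive; for \<open>0 < p < 9\<close> it starts by decreasing, hence is negative at first,
  and since it can only turn from decreasing to increasing, it stays negative on the whole
  interval exactly if it is not positive at the right end \<open>\<pi>/2\<close>. The latter condition reads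
  \<open>p (\<pi> - 3) \<le> 1\<close>.\<close>

definition cusa_frac :: "real \<Rightarrow> real \<Rightarrow> real" where
  "cusa_frac p c = (2*p + (p + 3) * c) / ((3*p + 1) + 2 * c)"

section \<open>Comparison with the Cusa bound\<close>

lemma cusa_frac_diff:
  assumes "3*p + 1 + 2*c \<noteq> 0"
  shows "cusa_frac p c - (2 + c)/3 = - (2 * (1 - c)^2 / (3 * (3*p + 1 + 2*c)))"
  using assms unfolding cusa_frac_def
  by (simp add: divide_simps) (simp add: algebra_simps power2_eq_square)

text \<open>The pole \<open>p = -(1 + 2c)/3\<close> lies between the two parts of the admissible range, so the
  sign of the denominator tells in which part \<open>p\<close> is.\<close>

lemma cusa_frac_vs_cusa:
  assumes "p \<in> {..-1} \<union> {0..}" "0 < c" "c < 1"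
  shows "cusa_frac p c < (2 + c)/3 \<longleftrightarrow> 0 \<le> p"
    and "(2 + c)/3 < cusa_frac p c \<longleftrightarrow> p \<le> -1"
proof -
  define N where "N = 3*p + 1 + 2*c"
  have sq: "0 < 2 * (1 - c)^2" using assms by simp
  have pos: "N > 0" if "0 \<le> p" using that assms by (simp add: N_def)
  have neg: "N < 0" if "p \<le> -1" using that assms by (simp add: N_def)
  have N0: "N \<noteq> 0" using pos neg assms(1) by fastforce
  have diff: "cusa_frac p c - (2 + c)/3 = - (2 * (1 - c)^2 / (3 * N))"
    using cusa_frac_diff[of p c] N0 by (simp add: N_def)
  have below: "cusa_frac p c < (2 + c)/3" if "0 \<le> p"
    using divide_pos_pos[OF sq, of "3*N"] pos[OF that] diff by linarith
  have above: "(2 + c)/3 < cusa_frac p c" if "p \<le> -1"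
    using divide_pos_neg[OF sq, of "3*N"] neg[OF that] diff by linarith
  show "cusa_frac p c < (2 + c)/3 \<longleftrightarrow> 0 \<le> p"
    using below above assms(1) by fastforce
  show "(2 + c)/3 < cusa_frac p c \<longleftrightarrow> p \<le> -1"
    using below above assms(1) by fastforce
qed

section \<open>Comparison with the cube root of the cosine\<close>

lemma cusa_frac_cube_diff:
  assumes "0 \<le> p" "0 < u"
  shows "cusa_frac p (u^3) - u
       = (1 - u)^2 * (p * (2 + u) - u * (1 + 2*u)) / (3*p + 1 + 2*u^3)"
proof -
  have "3*p + 1 + 2*u^3 > 0" using assms by (simp add: add_pos_pos)
  then show ?thesis
    unfolding cusa_frac_def
    by (simp add: divide_simps) (simp add: algebra_simps power2_eq_square power3_eq_cube)
qed

lemma cusa_frac_vs_cube_root: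
  assumes "0 \<le> p" "0 < u" "u < 1"
  shows "cusa_frac p (u^3) < u \<longleftrightarrow> p * (2 + u) < u * (1 + 2*u)"
    and "u < cusa_frac p (u^3) \<longleftrightarrow> u * (1 + 2*u) < p * (2 + u)"
proof -
  define K where "K = (1 - u)^2 / (3*p + 1 + 2*u^3)"
  have "3*p + 1 + 2*u^3 > 0" using assms by (simp add: add_pos_pos)
  then have "K > 0" using assms by (simp add: K_def)
  moreover have "cusa_frac p (u^3) - u = K * (p * (2 + u) - u * (1 + 2*u))"
    using cusa_frac_cube_diff[of p u] assms by (simp add: K_def)
  ultimately show "cusa_frac p (u^3) < u \<longleftrightarrow> p * (2 + u) < u * (1 + 2*u)"
    and "u < cusa_frac p (u^3) \<longleftrightarrow> u * (1 + 2*u) < p * (2 + u)"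
    by (metis diff_gt_0_iff_gt diff_less_0_iff_less mult_less_0_iff not_less_iff_gr_or_eq,
        metis diff_gt_0_iff_gt zero_less_mult_pos mult_pos_pos)
qed

text \<open>As \<open>t\<close> runs through \<open>(0, \<pi>/2)\<close>, the cube root of \<open>cos t\<close> runs through \<open>(0, 1)\<close>.\<close>

lemma all_cos_cube_root_iff:
  fixes P :: "real \<Rightarrow> real \<Rightarrow> bool"
  shows "(\<forall>t\<in>{0<..<pi/2}. P (cos t) (cos t powr (1/3))) \<longleftrightarrow> (\<forall>u\<in>{0<..<1}. P (u^3) u)"
    (is "?L \<longleftrightarrow> ?R")
proof
  assume L: ?L
  show ?R
  proof
    fix u :: real assume u: "u \<in> {0<..<1}"
    then have c: "0 < u^3" "u^3 < 1" by (auto simp: power_less_one_iff)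
    then have lb: "-1 \<le> u^3" by linarith
    from arccos_less_arccos[OF lb c(2)] have "0 < arccos (u^3)" by simp
    then have "arccos (u^3) \<in> {0<..<pi/2}"
      using c arccos_less_arccos[of 0 "u^3"] by simp
    moreover have "cos (arccos (u^3)) = u^3" using cos_arccos[OF lb] c(2) by linarith
    moreover have "(u^3) powr (1/3) = u"
      using u powr_powr[of u 3 "1/3"] by (simp add: powr_realpow)
    ultimately show "P (u^3) u" using L by fastforce
  qed
next
  assume R: ?R
  show ?L
  proof
    fix t :: real assume t: "t \<in> {0<..<pi/2}"
    have c: "0 < cos t" "cos t < 1"
      using t cos_gt_zero[of t] cos_monotone_0_pi[of 0 t] by auto
    have "(cos t powr (1/3))^3 = cos t"
      using c powr_power[of "cos t" "1/3" 3] by simp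
    moreover have "cos t powr (1/3) \<in> {0<..<1}"
      using c powr_less_mono2[of "1/3" "cos t" 1] by simp
    ultimately show "P (cos t) (cos t powr (1/3))" using R by metis
  qed
qed

lemma cusa_frac_below_cube_root_iff:
  assumes "0 \<le> p"
  shows "(\<forall>t\<in>{0<..<pi/2}. cusa_frac p (cos t) < cos t powr (1/3)) \<longleftrightarrow> p = 0"
proof -
  have "(\<forall>u\<in>{0<..<1}. p * (2 + u) < u * (1 + 2*u)) \<longleftrightarrow> p = 0"
  proof
    assume all: "\<forall>u\<in>{0<..<1}. p * (2 + u) < u * (1 + 2*u)"
    show "p = 0"
    proof (rule ccontr)
      assume "p \<noteq> 0"
      with assms have p: "p > 0" by simp
      \<comment> \<open>Since \<open>2p < p(2+u) < u(1+2u) < 3u\<close>, any \<open>u \<le> p/2\<close> is impossible.\<close>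
      define u where "u = min (1/2) (p/2)"
      have u: "0 < u" "u < 1" "u \<le> p/2" using p by (auto simp: u_def)
      have "p * (2 + u) < u * (1 + 2*u)" using all u by simp
      moreover have "p * 2 < p * (2 + u)" using p u by simp
      moreover have "u * (1 + 2*u) < u * 3" using u by simp
      ultimately show False using u p by linarith
    qed
  next
    assume "p = 0"
    then show "\<forall>u\<in>{0<..<1}. p * (2 + u) < u * (1 + 2*u)" by (simp add: add_pos_pos)
  qed
  then show ?thesis
    using all_cos_cube_root_iff[of "\<lambda>c w. cusa_frac p c < w"]
    by (simp add: cusa_frac_vs_cube_root(1)[OF assms])
qed

lemma cusa_frac_above_cube_root_iff:
  assumes "0 \<le> q"
  shows "(\<forall>t\<in>{0<..<pi/2}. cos t powr (1/3) < cusa_frac q (cos t)) \<longleftrightarrow> 1 \<le> q"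
proof -
  have "(\<forall>u\<in>{0<..<1}. u * (1 + 2*u) < q * (2 + u)) \<longleftrightarrow> 1 \<le> q"
  proof
    assume all: "\<forall>u\<in>{0<..<1}. u * (1 + 2*u) < q * (2 + u)"
    show "1 \<le> q"
    proof (rule ccontr)
      assume q: "\<not> 1 \<le> q"
      \<comment> \<open>With \<open>q = 2u - 1\<close> the left side exceeds the right one by \<open>2(1 - u)\<close>.\<close>
      define u where "u = (1 + q)/2"
      have u: "0 < u" "u < 1" "q = 2*u - 1" using q assms by (auto simp: u_def field_simps)
      have "u * (1 + 2*u) < (2*u - 1) * (2 + u)" using all u by auto
      then show False using u by (simp add: algebra_simps)
    qed
  next
    assume q: "1 \<le> q"
    show "\<forall>u\<in>{0<..<1}. u * (1 + 2*u) < q * (2 + u)"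
    proof
      fix u :: real assume u: "u \<in> {0<..<1}"
      have "u * u < 1" using u mult_strict_mono[of u 1 u 1] by simp
      then have "u * (1 + 2*u) < 1 * (2 + u)" by (simp add: algebra_simps)
      also have "\<dots> \<le> q * (2 + u)" using q u by (intro mult_right_mono) auto
      finally show "u * (1 + 2*u) < q * (2 + u)" .
    qed
  qed
  then show ?thesis
    using all_cos_cube_root_iff[of "\<lambda>c w. w < cusa_frac q c"]
    by (simp add: cusa_frac_vs_cube_root(2)[OF assms])
qed

section \<open>Comparison with the sinc function\<close>

definition gap :: "real \<Rightarrow> real \<Rightarrow> real" where
  "gap p t = t - sin t * (3*p + 1 + 2 * cos t) / (2*p + (p + 3) * cos t)"

lemma gap_0 [simp]: "gap p 0 = 0"
  by (simp add: gap_def)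

lemma frac_sinc_sign:
  assumes "0 \<le> p" "t \<in> {0<..<pi/2}"
  shows "sin t / t < cusa_frac p (cos t) \<longleftrightarrow> 0 < gap p t"
    and "cusa_frac p (cos t) < sin t / t \<longleftrightarrow> gap p t < 0"
proof -
  have c: "0 < cos t" using assms cos_gt_zero[of t] by auto
  have "3*p + 1 + 2 * cos t > 0" "2*p + (p + 3) * cos t > 0" "t > 0"
    using assms c by (auto intro!: add_nonneg_pos mult_pos_pos)
  then show "sin t / t < cusa_frac p (cos t) \<longleftrightarrow> 0 < gap p t"
    and "cusa_frac p (cos t) < sin t / t \<longleftrightarrow> gap p t < 0"
    unfolding cusa_frac_def gap_def
    by (simp_all add: divide_simps mult.commute)
qed

text \<open>The numerator of the derivative is a cubic polynomial in \<open>cos t\<close>. It has the double zero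
  \<open>cos t = 1\<close>, because the fraction and \<open>sin t / t\<close> have the common expansion
  \<open>1 - t\<^sup>2/6 + O(t\<^sup>4)\<close> at \<open>0\<close>, so that the derivative is of order \<open>t\<^sup>4\<close>; this leaves a
  linear factor.\<close>

lemma gap_deriv:
  assumes "2*p + (p + 3) * cos t \<noteq> 0"
  shows "(gap p has_real_derivative
      (1 - cos t)^2 * (p^2 - 6*p - 3 - 2*(p + 3) * cos t) / (2*p + (p + 3) * cos t)^2) (at t)"
proof -
  define c where "c = cos t"
  define s where "s = sin t"
  define D where "D = 2*p + (p + 3) * c"
  define N where "N = 3*p + 1 + 2*c"
  have D0: "D \<noteq> 0" using assms by (simp add: D_def c_def)
  have ss: "s * s = 1 - c * c"
    using sin_squared_eq[of t] by (simp add: s_def c_def power2_eq_square)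
  have "(gap p has_real_derivative
      1 - ((c * N - s * (2 * s)) * D + s * N * ((p + 3) * s)) / D^2) (at t)"
    unfolding gap_def using assms
    by (auto intro!: derivative_eq_intros simp: c_def s_def N_def D_def power2_eq_square)
  moreover have "1 - ((c * N - s * (2 * s)) * D + s * N * ((p + 3) * s)) / D^2
      = (1 - c)^2 * (p^2 - 6*p - 3 - 2*(p + 3) * c) / D^2"
  proof -
    have "(c * N - s * (2 * s)) * D + s * N * ((p + 3) * s)
        = (c * N - 2 * (s * s)) * D + (s * s) * N * (p + 3)"
      by (simp add: algebra_simps)
    then have "D^2 - ((c * N - s * (2 * s)) * D + s * N * ((p + 3) * s))
        = (1 - c)^2 * (p^2 - 6*p - 3 - 2*(p + 3) * c)"
      unfolding ss D_def N_def by (simp add: algebra_simps power2_eq_square)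
    then show ?thesis using D0 by (simp add: field_simps)
  qed
  ultimately show ?thesis by (simp add: c_def D_def)
qed

text \<open>Only the linear factor matters for the sign. The denominator vanishes for \<open>p = 0\<close> at the
  right end point, hence the last hypothesis.\<close>

lemma gap_mvt:
  assumes "0 \<le> p" "0 \<le> a" "a < b" "b \<le> pi/2" "0 < p \<or> b < pi/2"
  obtains x K where "a < x" "x < b" "0 < K"
    "gap p b - gap p a = K * (p^2 - 6*p - 3 - 2*(p + 3) * cos x)"
proof -
  let ?D = "\<lambda>x. 2*p + (p + 3) * cos x"
  let ?d = "\<lambda>x. (1 - cos x)^2 * (p^2 - 6*p - 3 - 2*(p + 3) * cos x) / (?D x)^2"
  have D: "?D x > 0" if "a \<le> x" "x \<le> b" for x
  proof (cases "x < pi/2")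
    case True
    then have "cos x > 0" using that assms by (intro cos_gt_zero_pi) auto
    then show ?thesis using assms by (auto intro!: add_nonneg_pos mult_pos_pos)
  next
    case False
    then have x: "x = pi/2" and "0 < p" using that assms by auto
    then show ?thesis unfolding x cos_pi_half by simp
  qed
  have "\<exists>x. a < x \<and> x < b \<and> gap p b - gap p a = (b - a) * ?d x"
  proof (rule MVT2[OF assms(3)])
    fix x assume "a \<le> x" "x \<le> b"
    then show "(gap p has_real_derivative ?d x) (at x)"
      using gap_deriv[of p x] D[of x] by simp
  qed
  then obtain x where x: "a < x" "x < b" "gap p b - gap p a = (b - a) * ?d x" by blast
  have "cos x < 1" using cos_monotone_0_pi[of 0 x] x assms by simp
  then have "0 < (b - a) * ((1 - cos x)^2 / (?D x)^2)"
    using D[of x] x by (intro mult_pos_pos divide_pos_pos) auto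
  then show ?thesis using x that[of x "(b - a) * ((1 - cos x)^2 / (?D x)^2)"] by simp
qed

lemma gap_pos:
  assumes "9 \<le> r" "0 < t" "t \<le> pi/2"
  shows "0 < gap r t"
proof -
  obtain x K where x: "0 < x" "x < t" "0 < K"
    "gap r t - gap r 0 = K * (r^2 - 6*r - 3 - 2*(r + 3) * cos x)"
    using gap_mvt[of r 0 t] assms by auto
  have "cos x < 1" using cos_monotone_0_pi[of 0 x] x assms by simp
  then have "2*(r + 3) * cos x < 2*(r + 3)" using assms by simp
  moreover have "0 \<le> (r - 9) * (r + 1)" using assms by simp
  then have "2*(r + 3) \<le> r^2 - 6*r - 3" by (simp add: algebra_simps power2_eq_square)
  ultimately show ?thesis using x by simp
qed

text \<open>Near \<open>0\<close> the derivative of the gap is negative as soon as \<open>(r - 9)(r + 1) < 0\<close>.\<close>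

lemma gap_neg_near_0:
  assumes "0 \<le> r" "r < 9"
  shows "\<exists>t\<in>{0<..<pi/2}. gap r t < 0"
proof -
  \<comment> \<open>Left of \<open>arccos k\<close> the linear factor of the derivative is negative.\<close>
  define k where "k = max 0 ((r^2 - 6*r - 3) / (2*(r + 3)))"
  define t where "t = arccos k / 2"
  have "(r - 9) * (r + 1) < 0" using assms by (simp add: mult_neg_pos)
  then have "r^2 - 6*r - 3 < 2*(r + 3)" by (simp add: algebra_simps power2_eq_square)
  then have k: "0 \<le> k" "k < 1" using assms by (auto simp: k_def)
  have ac: "0 < arccos k" "arccos k \<le> pi/2"
    using k arccos_lt_bounded[of k] arccos_le_pi2[of k] by auto
  then have t: "0 < t" "t < pi/2" "t < arccos k" by (auto simp: t_def)
  obtain x K where x: "0 < x" "x < t" "0 < K"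
    "gap r t - gap r 0 = K * (r^2 - 6*r - 3 - 2*(r + 3) * cos x)"
    using gap_mvt[of r 0 t] assms t by auto
  have "k < cos x" using cos_monotone_0_pi[of x "arccos k"] x t ac k by simp
  then have "(r^2 - 6*r - 3) / (2*(r + 3)) < cos x" by (simp add: k_def)
  then have "r^2 - 6*r - 3 < 2*(r + 3) * cos x"
    using assms by (simp add: divide_less_eq mult.commute)
  then have "gap r t < 0" using x by (simp add: mult_pos_neg)
  then show ?thesis using t by auto
qed

text \<open>A nonnegative value inside the interval would force the gap to rise somewhere before it
  and to fall somewhere after it, but the linear factor of the derivative increases with \<open>t\<close>.\<close>

lemma gap_neg:
  assumes q: "0 < q" and e: "gap q (pi/2) \<le> 0" and t: "t \<in> {0<..<pi/2}"
  shows "gap q t < 0"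
proof (rule ccontr)
  assume n: "\<not> gap q t < 0"
  obtain x K where x: "0 < x" "x < t" "0 < K"
    "gap q t - gap q 0 = K * (q^2 - 6*q - 3 - 2*(q + 3) * cos x)"
    using gap_mvt[of q 0 t] q t by auto
  obtain y L where y: "t < y" "y < pi/2" "0 < L"
    "gap q (pi/2) - gap q t = L * (q^2 - 6*q - 3 - 2*(q + 3) * cos y)"
    using gap_mvt[of q t "pi/2"] q t by auto
  have "0 \<le> K * (q^2 - 6*q - 3 - 2*(q + 3) * cos x)" using x n by simp
  then have "2*(q + 3) * cos x \<le> q^2 - 6*q - 3" using x by (simp add: zero_le_mult_iff)
  moreover have "L * (q^2 - 6*q - 3 - 2*(q + 3) * cos y) \<le> 0" using y n e by linarith
  then have "q^2 - 6*q - 3 \<le> 2*(q + 3) * cos y" using y by (simp add: mult_le_0_iff)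
  moreover have "cos y < cos x" using cos_monotone_0_pi[of x y] x y by simp
  then have "2*(q + 3) * cos y < 2*(q + 3) * cos x" using q by simp
  ultimately show False by linarith
qed

lemma gap_pi_half: "gap q (pi/2) = pi/2 - (3*q + 1) / (2*q)"
  by (simp add: gap_def)

lemma pi_gt_3: "3 < pi"
  using gap_pos[of 9 "pi/2"] by (simp add: gap_pi_half)

lemma sinc_below_frac_iff:
  assumes "0 \<le> r"
  shows "(\<forall>t\<in>{0<..<pi/2}. sin t / t < cusa_frac r (cos t)) \<longleftrightarrow> 9 \<le> r"
proof -
  have "(\<forall>t\<in>{0<..<pi/2}. 0 < gap r t) \<longleftrightarrow> 9 \<le> r"
    using gap_neg_near_0[OF assms] gap_pos[of r] by (fastforce simp: not_le[symmetric])
  then show ?thesis by (simp add: frac_sinc_sign(1)[OF assms])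
qed

lemma frac_below_sinc_iff:
  assumes "0 < q"
  shows "(\<forall>t\<in>{0<..<pi/2}. cusa_frac q (cos t) < sin t / t) \<longleftrightarrow> q \<le> inverse (pi - 3)"
proof -
  have "(\<forall>t\<in>{0<..<pi/2}. gap q t < 0) \<longleftrightarrow> gap q (pi/2) \<le> 0"
  proof
    assume neg: "\<forall>t\<in>{0<..<pi/2}. gap q t < 0"
    have "isCont (gap q) (pi/2)"
      using gap_deriv[of q "pi/2"] assms by (auto intro: DERIV_isCont)
    then have "(gap q \<longlongrightarrow> gap q (pi/2)) (at_left (pi/2))"
      by (auto simp: isCont_def intro: filterlim_mono at_le)
    moreover have "\<forall>\<^sub>F t in at_left (pi/2). gap q t \<le> 0"
      using eventually_at_left_real[of 0 "pi/2"] neg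
      by (auto elim!: eventually_mono intro: less_imp_le)
    ultimately show "gap q (pi/2) \<le> 0"
      by (intro tendsto_upperbound[of "gap q" _ "at_left (pi/2)"]) auto
  qed (use gap_neg[OF assms] in blast)
  also have "\<dots> \<longleftrightarrow> q \<le> inverse (pi - 3)"
    using assms pi_gt_3 by (simp add: gap_pi_half field_simps)
  finally show ?thesis by (simp add: frac_sinc_sign(2) assms less_imp_le)
qed

section \<open>The chain of inequalities\<close>

theorem theorem3:
  fixes p q r s :: real
  assumes "p \<in> {..-1} \<union> {0..}" and "q \<in> {..-1} \<union> {0..}"
    and "r \<in> {..-1} \<union> {0..}" and "s \<in> {..-1} \<union> {0..}"
  shows "(\<forall>t\<in>{0<..<pi/2}.
            (2*p + (p + 3) * cos t) / ((3*p + 1) + 2 * cos t) < cos t powr (1/3) \<and>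
            cos t powr (1/3) < (2*q + (q + 3) * cos t) / ((3*q + 1) + 2 * cos t) \<and>
            (2*q + (q + 3) * cos t) / ((3*q + 1) + 2 * cos t) < sin t / t \<and>
            sin t / t < (2*r + (r + 3) * cos t) / ((3*r + 1) + 2 * cos t) \<and>
            (2*r + (r + 3) * cos t) / ((3*r + 1) + 2 * cos t) < (2 + cos t) / 3 \<and>
            (2 + cos t) / 3 < (2*s + (s + 3) * cos t) / ((3*s + 1) + 2 * cos t))
         \<longleftrightarrow> p = 0 \<and> q \<in> {1..inverse (pi - 3)} \<and> r \<in> {9..} \<and> s \<in> {..-1}"
proof -
  let ?I = "{0<..<pi/2}"
  have c: "0 < cos t" "cos t < 1" if "t \<in> ?I" for t
    using that cos_gt_zero[of t] cos_monotone_0_pi[of 0 t] by auto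
  let ?chain = "\<forall>t\<in>?I. cusa_frac p (cos t) < cos t powr (1/3)
      \<and> cos t powr (1/3) < cusa_frac q (cos t) \<and> cusa_frac q (cos t) < sin t / t
      \<and> sin t / t < cusa_frac r (cos t) \<and> cusa_frac r (cos t) < (2 + cos t) / 3
      \<and> (2 + cos t) / 3 < cusa_frac s (cos t)"
  have I: "pi/4 \<in> ?I" by simp
  have "?chain \<longleftrightarrow> p = 0 \<and> q \<in> {1..inverse (pi - 3)} \<and> r \<in> {9..} \<and> s \<in> {..-1}"
  proof
    assume A: ?chain
    \<comment> \<open>A single point shows in which part of the admissible range each parameter is.\<close>
    let ?c = "cos (pi/4)"
    have "cusa_frac p ?c < (2 + ?c)/3" "cusa_frac q ?c < (2 + ?c)/3"
      "cusa_frac r ?c < (2 + ?c)/3" "(2 + ?c)/3 < cusa_frac s ?c"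
      using bspec[OF A I] by linarith+
    then have sgn: "0 \<le> p" "0 \<le> q" "0 \<le> r" "s \<le> -1"
      using cusa_frac_vs_cusa c[OF I] assms by blast+
    have "p = 0" using A cusa_frac_below_cube_root_iff[OF sgn(1)] by blast
    moreover have "1 \<le> q" using A cusa_frac_above_cube_root_iff[OF sgn(2)] by blast
    moreover from this have "q \<le> inverse (pi - 3)" using A frac_below_sinc_iff[of q] by simp
    moreover have "9 \<le> r" using A sinc_below_frac_iff[OF sgn(3)] by blast
    ultimately show "p = 0 \<and> q \<in> {1..inverse (pi - 3)} \<and> r \<in> {9..} \<and> s \<in> {..-1}"
      using sgn by simp
  next
    assume B: "p = 0 \<and> q \<in> {1..inverse (pi - 3)} \<and> r \<in> {9..} \<and> s \<in> {..-1}"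
    show ?chain
      using B cusa_frac_below_cube_root_iff[of p] cusa_frac_above_cube_root_iff[of q]
        frac_below_sinc_iff[of q] sinc_below_frac_iff[of r]
        cusa_frac_vs_cusa(1)[OF assms(3)] cusa_frac_vs_cusa(2)[OF assms(4)] c
      by auto
  qed
  then show ?thesis unfolding cusa_frac_def .
qed

end
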